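(* Let the background flow $(u_0,p_0,\rho_0,\varphi_0,c_0)$ satisfy Euler's equations, let $(\delta u,\delta\rho,\delta p)$ satisfy the linearized Euler's equations (both written out in the context), and let the Lagrangian displacement $w$ satisfy $$(\partial_t+\mathcal L_{u_0})w=D_0w-(w\cdot\nabla)u_0=\delta u .$$ Provided that the fields involved are regular enough, $$\rho_0D_0\left(\frac{\delta\rho+\nabla\cdot(\rho_0w)}{\rho_0}\right)=0 .$$ If moreover the "no resonance" assumption holds, that is, if the preceding equation implies that $$\delta\rho+\nabla\cdot(\rho_0w)=0,$$ then $w$ solves Galbrun's equation $$\rho_0D_0\big(D_0w-(w\cdot\nabla)u_0\big)-\nabla\big(c_0^2\nabla\cdot(\rho_0w)\big)+\rho_0\big((D_0w-(w\cdot\nabla)u_0)\cdot\nabla\big)u_0+\frac{\nabla p_0}{\rho_0}\nabla\cdot(\rho_0w)=\rho_0\,\delta\varphi .$$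
   Context: All fields depend on position $x$ in a spatial domain in $\mathbb R^d$ and on time $t$, and the equations are understood there. $D_0=\partial_t+u_0\cdot\nabla$ is the material derivative, and $\mathcal L_{u_0}w=(u_0\cdot\nabla)w-(w\cdot\nabla)u_0$ is the Lie derivative of the vector field $w$ along $u_0$. Background flow (inviscid fluid that either undergoes homentropic flow or is elastic, i.e. has an equation of state independent of the entropy): velocity $u_0$, pressure $p_0$, density $\rho_0$ (positive), volume force density $\varphi_0$, speed of sound $c_0=\sqrt{\Sigma'(\rho_0)}$, with Euler's equations $\rho_0D_0u_0+\nabla p_0=\rho_0\varphi_0$, $\;D_0\rho_0+\rho_0\nabla\cdot u_0=0$, $\;p_0=\Sigma(\rho_0)$, where $\Sigma$ is the given equation of state. Linearized Euler's equations for the Eulerian perturbations $\delta u$ (vector), $\delta\rho$, $\delta p$ (scalars), with given volume force density $\delta\varphi$: $$\rho_0D_0\,\delta u+\nabla\delta p+\rho_0(\delta u\cdot\nabla)u_0-\frac{\nabla p_0}{\rho_0}\delta\rho=\rho_0\,\delta\varphi,$$ $$D_0\,\delta\rho+\rho_0\nabla\cdot\delta u+(\delta u\cdot\nabla)\rho_0+(\nabla\cdot u_0)\delta\rho=0,\qquad \delta p=c_0^2\,\delta\rho .$$ "Regular enough" is used without specifying function classes. *)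

theory Defs
  imports "HOL-Analysis.Analysis"
begin

text \<open>Fields are functions of a pair \<open>(x, t)\<close> of a position in \<open>\<real>\<^sup>d\<close>, with \<open>d = CARD('n)\<close>,
  and a time.\<close>

type_synonym 'n spacetime = "(real ^ 'n) \<times> real"
type_synonym 'n sfield = "'n spacetime \<Rightarrow> real"
type_synonym 'n vfield = "'n spacetime \<Rightarrow> real ^ 'n"

text \<open>Functions of class \<open>C\<^sup>k\<close> on an open set (jointly in all variables, so in space and time).\<close>

primrec C_k_on ::
  "nat \<Rightarrow> 'a::euclidean_space set \<Rightarrow> ('a \<Rightarrow> 'b::real_normed_vector) \<Rightarrow> bool" where
  "C_k_on 0 S f \<longleftrightarrow> continuous_on S f"
| "C_k_on (Suc k) S f \<longleftrightarrow>
     (\<forall>z\<in>S. f differentiable (at z)) \<and>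
     (\<forall>b\<in>Basis. C_k_on k S (\<lambda>z. frechet_derivative f (at z) b))"

definition partial_t :: "('n::finite spacetime \<Rightarrow> 'b::real_normed_vector) \<Rightarrow> 'n spacetime \<Rightarrow> 'b" where
  "partial_t f z = vector_derivative (\<lambda>s. f (fst z, s)) (at (snd z))"

definition partial_x ::
  "'n \<Rightarrow> ('n::finite spacetime \<Rightarrow> 'b::real_normed_vector) \<Rightarrow> 'n spacetime \<Rightarrow> 'b" where
  "partial_x i f z = vector_derivative (\<lambda>h. f (fst z + h *\<^sub>R axis i 1, snd z)) (at 0)"

definition grad :: "'n::finite sfield \<Rightarrow> 'n vfield" where
  "grad f z = (\<chi> i. partial_x i f z)"

definition divergence :: "'n::finite vfield \<Rightarrow> 'n sfield" where
  "divergence v z = (\<Sum>i\<in>UNIV. partial_x i (\<lambda>y. v y $ i) z)"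

text \<open>\<open>(v \<cdot> \<nabla>) f\<close>, for \<open>f\<close> a scalar or a vector field.\<close>

definition advect ::
  "'n::finite vfield \<Rightarrow> ('n spacetime \<Rightarrow> 'b::real_normed_vector) \<Rightarrow> 'n spacetime \<Rightarrow> 'b" where
  "advect v f z = (\<Sum>i\<in>UNIV. (v z $ i) *\<^sub>R partial_x i f z)"

definition material_deriv ::
  "'n::finite vfield \<Rightarrow> ('n spacetime \<Rightarrow> 'b::real_normed_vector) \<Rightarrow> 'n spacetime \<Rightarrow> 'b" where
  "material_deriv u f z = partial_t f z + advect u f z"

definition lie_deriv :: "'n::finite vfield \<Rightarrow> 'n vfield \<Rightarrow> 'n vfield" where
  "lie_deriv u w z = advect u w z - advect w u z"

lemma partial_t_plus_lie_deriv:
  "partial_t w z + lie_deriv u w z = material_deriv u w z - advect w u z"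
  by (simp add: lie_deriv_def material_deriv_def)

definition euler_flow ::
  "'n::finite spacetime set \<Rightarrow> (real \<Rightarrow> real) \<Rightarrow>
   'n vfield \<Rightarrow> 'n sfield \<Rightarrow> 'n sfield \<Rightarrow> 'n vfield \<Rightarrow> bool" where
  "euler_flow Q \<Sigma> u p \<rho> \<phi> \<longleftrightarrow>
     (\<forall>z\<in>Q.
        \<rho> z *\<^sub>R material_deriv u u z + grad p z = \<rho> z *\<^sub>R \<phi> z \<and>
        material_deriv u \<rho> z + \<rho> z * divergence u z = 0 \<and>
        p z = \<Sigma> (\<rho> z))"

definition linearized_euler ::
  "'n::finite spacetime set \<Rightarrow>
   'n vfield \<Rightarrow> 'n sfield \<Rightarrow> 'n sfield \<Rightarrow> 'n sfield \<Rightarrow>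
   'n vfield \<Rightarrow> 'n sfield \<Rightarrow> 'n sfield \<Rightarrow> 'n vfield \<Rightarrow> bool" where
  "linearized_euler Q u0 p0 \<rho>0 c0 \<delta>u \<delta>p \<delta>\<rho> \<delta>\<phi> \<longleftrightarrow>
     (\<forall>z\<in>Q.
        \<rho>0 z *\<^sub>R material_deriv u0 \<delta>u z + grad \<delta>p z + \<rho>0 z *\<^sub>R advect \<delta>u u0 z
          - \<delta>\<rho> z *\<^sub>R ((1 / \<rho>0 z) *\<^sub>R grad p0 z) = \<rho>0 z *\<^sub>R \<delta>\<phi> z \<and>
        material_deriv u0 \<delta>\<rho> z + \<rho>0 z * divergence \<delta>u z + advect \<delta>u \<rho>0 z
          + divergence u0 z * \<delta>\<rho> z = 0 \<and>
        \<delta>p z = (c0 z)\<^sup>2 * \<delta>\<rho> z)"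

definition galbrun ::
  "'n::finite spacetime set \<Rightarrow>
   'n vfield \<Rightarrow> 'n sfield \<Rightarrow> 'n sfield \<Rightarrow> 'n sfield \<Rightarrow>
   'n vfield \<Rightarrow> 'n vfield \<Rightarrow> bool" where
  "galbrun Q u0 p0 \<rho>0 c0 w \<delta>\<phi> \<longleftrightarrow>
     (\<forall>z\<in>Q.
        \<rho>0 z *\<^sub>R material_deriv u0 (\<lambda>y. material_deriv u0 w y - advect w u0 y) z
        - grad (\<lambda>y. (c0 y)\<^sup>2 * divergence (\<lambda>y'. \<rho>0 y' *\<^sub>R w y') y) z
        + \<rho>0 z *\<^sub>R advect (\<lambda>y. material_deriv u0 w y - advect w u0 y) u0 z
        + divergence (\<lambda>y. \<rho>0 y *\<^sub>R w y) z *\<^sub>R ((1 / \<rho>0 z) *\<^sub>R grad p0 z)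
        = \<rho>0 z *\<^sub>R \<delta>\<phi> z)"

end

theory Submission
  imports Defs
begin

text \<open>With \<open>q = \<nabla>\<cdot>(\<rho>\<^sub>0 w)\<close>, the continuity equation and the equation for \<open>w\<close> give
  \<open>D\<^sub>0 (\<rho>\<^sub>0 w) = \<rho>\<^sub>0 \<delta>u + (\<rho>\<^sub>0 w \<cdot> \<nabla>) u\<^sub>0 - (\<nabla>\<cdot>u\<^sub>0) \<rho>\<^sub>0 w\<close>. In the divergence of this identity the
  terms with second derivatives of \<open>u\<^sub>0\<close> cancel, and the commutator of \<open>\<nabla>\<cdot>\<close> with \<open>D\<^sub>0\<close> cancels
  the sum of the \<open>\<partial>\<^sub>i(\<rho>\<^sub>0 w)\<^sub>j \<partial>\<^sub>j(u\<^sub>0)\<^sub>i\<close>; what remains is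
  \<open>D\<^sub>0 q + q (\<nabla>\<cdot>u\<^sub>0) = \<nabla>\<cdot>(\<rho>\<^sub>0 \<delta>u)\<close>. Adding the linearized continuity equation shows that
  \<open>m = \<delta>\<rho> + q\<close> satisfies the same equation \<open>D\<^sub>0 m + m (\<nabla>\<cdot>u\<^sub>0) = 0\<close> as \<open>\<rho>\<^sub>0\<close>, so that
  \<open>m / \<rho>\<^sub>0\<close> is constant along the flow. If \<open>m = 0\<close>, substituting \<open>\<delta>\<rho> = -q\<close> and
  \<open>\<delta>p = -c\<^sub>0\<^sup>2 q\<close> in the linearized momentum equation gives Galbrun's equation.\<close>

section \<open>Symmetry of second derivatives\<close>

text \<open>The mean value theorem in direction \<open>a\<close>, applied to the difference of
  \<open>f\<close> along two parallel sides of a parallelogram at \<open>z\<close>, turns the second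
  difference into \<open>h\<close> times an increment of the derivative along \<open>a\<close>.
  Differentiability of that derivative at \<open>z\<close> makes the increment
  \<open>h * L b\<close> up to o(h).\<close>

lemma second_difference_quotient_tendsto:
  fixes f :: "'a::real_normed_vector \<Rightarrow> real"
  assumes "open S" "z \<in> S"
    and df: "\<And>y. y \<in> S \<Longrightarrow> f differentiable (at y)"
    and d2: "((\<lambda>y. frechet_derivative f (at y) a) has_derivative L) (at z)"
  shows "((\<lambda>h. (f (z + h *\<^sub>R a + h *\<^sub>R b) - f (z + h *\<^sub>R a) - f (z + h *\<^sub>R b) + f z) / h\<^sup>2)
           \<longlongrightarrow> L b) (at_right 0)"
proof (rule tendstoI)
  let ?\<Delta> = "\<lambda>h. f (z + h *\<^sub>R a + h *\<^sub>R b) - f (z + h *\<^sub>R a) - f (z + h *\<^sub>R b) + f z"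
  let ?F = "\<lambda>y. frechet_derivative f (at y) a"
  interpret L: bounded_linear L using d2 by (rule has_derivative_bounded_linear)
  fix e :: real assume "0 < e"
  \<comment> \<open>\<open>K\<close> dominates \<open>norm a + norm b\<close>, so points of the
    parallelogram of size \<open>h\<close> lie within \<open>h * K\<close> of \<open>z\<close>. The
    summand 1 keeps \<open>K\<close> positive when \<open>a\<close> and \<open>b\<close> vanish and
    makes the estimate \<open>n2'\<close> strict.\<close>
  define K where "K = 2 * norm a + norm b + 1"
  have K: "0 < K" by (simp add: K_def add_nonneg_pos)
  obtain r where r: "0 < r" "ball z r \<subseteq> S"
    using \<open>open S\<close> \<open>z \<in> S\<close> open_contains_ball by blast
  \<comment> \<open>The linear approximation is used at two points, each at distance at most
    \<open>h * K\<close> from \<open>z\<close>; this accuracy costs \<open>e / 2 * h\<close> per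
    point.\<close>
  have "0 < e / (2 * K)" using \<open>0 < e\<close> K by simp
  then obtain d where d: "0 < d"
    and dF: "\<And>y. norm (y - z) < d \<Longrightarrow> \<bar>?F y - ?F z - L (y - z)\<bar> \<le> e / (2 * K) * norm (y - z)"
    using d2 unfolding has_derivative_at_alt real_norm_def by blast
  define m where "m = min r d / K"
  have m: "0 < m" using r d K by (simp add: m_def)
  have small: "norm (s *\<^sub>R a + t *\<^sub>R b) < min r d" "norm (s *\<^sub>R a + t *\<^sub>R b) \<le> h * K"
    if "0 \<le> s" "s \<le> h" "0 \<le> t" "t \<le> h" "0 < h" "h < m" for s t h
  proof -
    have "norm (s *\<^sub>R a + t *\<^sub>R b) \<le> s * norm a + t * norm b"
      using norm_triangle_ineq[of "s *\<^sub>R a" "t *\<^sub>R b"] that by simp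
    also have "\<dots> \<le> h * norm a + h * norm b"
      using that by (intro add_mono mult_right_mono) auto
    also have "\<dots> \<le> h * K"
      using that by (simp add: K_def algebra_simps)
    finally show *: "norm (s *\<^sub>R a + t *\<^sub>R b) \<le> h * K" .
    have "h * K < min r d" using that K by (simp add: m_def field_simps)
    with * show "norm (s *\<^sub>R a + t *\<^sub>R b) < min r d" by simp
  qed
  have bound: "dist (?\<Delta> h / h\<^sup>2) (L b) < e" if h: "0 < h" "h < m" for h
  proof -
    have inS: "z + t *\<^sub>R a + c *\<^sub>R b \<in> S" if "0 \<le> t" "t \<le> h" "0 \<le> c" "c \<le> h" for t c
    proof -
      have "dist z (z + t *\<^sub>R a + c *\<^sub>R b) = norm (t *\<^sub>R a + c *\<^sub>R b)"
        using norm_minus_cancel[of "t *\<^sub>R a + c *\<^sub>R b"]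
        by (simp add: dist_norm algebra_simps)
      then show ?thesis
        using small(1)[OF that h] r(2) by (auto simp: subset_iff)
    qed
    \<comment> \<open>Here \<open>c\<close> selects a side parallel to \<open>a\<close>: it is used
      with \<open>c = h\<close> and \<open>c = 0\<close>.\<close>
    have der: "((\<lambda>t. f (z + t *\<^sub>R a + c *\<^sub>R b)) has_derivative
        (\<lambda>s. s * ?F (z + t *\<^sub>R a + c *\<^sub>R b))) (at t)"
      if "0 \<le> t" "t \<le> h" "0 \<le> c" "c \<le> h" for t c
    proof -
      have 1: "(f has_derivative frechet_derivative f (at (z + t *\<^sub>R a + c *\<^sub>R b)))
          (at (z + t *\<^sub>R a + c *\<^sub>R b))"
        using df[OF inS[OF that]] frechet_derivative_works by blast
      have 2: "((\<lambda>t. z + t *\<^sub>R a + c *\<^sub>R b) has_derivative (\<lambda>s. s *\<^sub>R a)) (at t)"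
        by (auto intro!: derivative_eq_intros)
      have "linear (frechet_derivative f (at (z + t *\<^sub>R a + c *\<^sub>R b)))"
        using 1 has_derivative_linear by blast
      then show ?thesis
        using diff_chain_at[OF 2 1] by (simp add: o_def linear_cmul)
    qed
    let ?g = "\<lambda>t. f (z + t *\<^sub>R a + h *\<^sub>R b) - f (z + t *\<^sub>R a)"
    have dg: "(?g has_derivative
        (\<lambda>s. s * (?F (z + t *\<^sub>R a + h *\<^sub>R b) - ?F (z + t *\<^sub>R a)))) (at t)"
      if "0 \<le> t" "t \<le> h" for t
      using has_derivative_diff[OF der[of t h] der[of t 0]] that h
      by (simp add: algebra_simps)
    have cont: "continuous_on {0..h} ?g"
      by (rule has_derivative_continuous_on) (use dg has_derivative_at_withinI in force)
    obtain s where s: "0 < s" "s < h"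
      and mvt_s: "?g h - ?g 0 = (h - 0) * (?F (z + s *\<^sub>R a + h *\<^sub>R b) - ?F (z + s *\<^sub>R a))"
      using h(1) cont dg[OF less_imp_le less_imp_le] by (rule mvt)
    have \<Delta>: "?\<Delta> h = h * (?F (z + s *\<^sub>R a + h *\<^sub>R b) - ?F (z + s *\<^sub>R a))"
      using mvt_s by simp
    let ?y1 = "s *\<^sub>R a + h *\<^sub>R b" and ?y2 = "s *\<^sub>R a"
    have n1: "norm ?y1 < d" "norm ?y1 \<le> h * K"
      using small[of s h h] s h by auto
    have n2: "norm ?y2 < d" "norm ?y2 \<le> h * K"
      using small[of s h 0] s h by auto
    have "\<bar>?F (z + ?y1) - ?F z - L ?y1\<bar> \<le> e / (2 * K) * norm ?y1"
      using dF[of "z + ?y1"] n1 by simp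
    also have "\<dots> \<le> e / (2 * K) * (h * K)"
      using n1 \<open>0 < e / (2 * K)\<close> by (intro mult_left_mono) auto
    also have "\<dots> = e / 2 * h" using K by simp
    finally have b1: "\<bar>?F (z + ?y1) - ?F z - L ?y1\<bar> \<le> e / 2 * h" .
    \<comment> \<open>One of the two estimates has to be strict, so that their sum stays strictly
      below \<open>e * h\<close>.\<close>
    have n2': "norm ?y2 < h * K"
    proof -
      have "norm ?y2 \<le> h * norm a"
        using s by (simp add: mult_right_mono)
      also have "\<dots> < h * K"
        using h by (simp add: K_def add_nonneg_pos)
      finally show ?thesis .
    qed
    have "\<bar>?F (z + ?y2) - ?F z - L ?y2\<bar> \<le> e / (2 * K) * norm ?y2"
      using dF[of "z + ?y2"] n2 by simp
    also have "\<dots> < e / (2 * K) * (h * K)"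
      using n2' \<open>0 < e / (2 * K)\<close> by (intro mult_strict_left_mono) auto
    also have "\<dots> = e / 2 * h" using K by simp
    finally have b2: "\<bar>?F (z + ?y2) - ?F z - L ?y2\<bar> < e / 2 * h" .
    \<comment> \<open>The intermediate point \<open>s\<close> of the mean value theorem is unknown,
      but by linearity its contribution \<open>s *\<^sub>R a\<close> drops out.\<close>
    have "L ?y1 - L ?y2 = h * L b" by (simp add: L.add L.scaleR)
    then have "\<bar>?F (z + ?y1) - ?F (z + ?y2) - h * L b\<bar> < e * h"
      using b1 b2 by (simp add: field_simps abs_if split: if_splits)
    moreover have "?\<Delta> h / h\<^sup>2 - L b = (?F (z + ?y1) - ?F (z + ?y2) - h * L b) / h"
      using h unfolding \<Delta> by (simp add: field_simps power2_eq_square add.assoc)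
    ultimately show ?thesis
      using h by (simp add: dist_real_def abs_divide pos_divide_less_eq)
  qed
  show "\<forall>\<^sub>F h in at_right 0. dist (?\<Delta> h / h\<^sup>2) (L b) < e"
    using m bound unfolding eventually_at_right_field by blast
qed

text \<open>The second difference quotient is symmetric in \<open>a\<close> and \<open>b\<close>,
  and by the previous lemma it converges to either mixed derivative; limits are unique.\<close>

lemma frechet_derivative_symmetric:
  fixes f :: "'a::real_normed_vector \<Rightarrow> real"
  assumes "open S" "z \<in> S"
    and "\<And>y. y \<in> S \<Longrightarrow> f differentiable (at y)"
    and a: "(\<lambda>y. frechet_derivative f (at y) a) differentiable (at z)"
    and b: "(\<lambda>y. frechet_derivative f (at y) b) differentiable (at z)"
  shows "frechet_derivative (\<lambda>y. frechet_derivative f (at y) a) (at z) b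
       = frechet_derivative (\<lambda>y. frechet_derivative f (at y) b) (at z) a"
proof (rule tendsto_unique[OF trivial_limit_at_right_real])
  let ?Q = "\<lambda>a b h. (f (z + h *\<^sub>R a + h *\<^sub>R b) - f (z + h *\<^sub>R a) - f (z + h *\<^sub>R b) + f z) / h\<^sup>2"
  show "(?Q a b \<longlongrightarrow> frechet_derivative (\<lambda>y. frechet_derivative f (at y) a) (at z) b) (at_right 0)"
    using assms(1-3) a[unfolded frechet_derivative_works]
    by (rule second_difference_quotient_tendsto)
  have "(?Q b a \<longlongrightarrow> frechet_derivative (\<lambda>y. frechet_derivative f (at y) b) (at z) a) (at_right 0)"
    using assms(1-3) b[unfolded frechet_derivative_works]
    by (rule second_difference_quotient_tendsto)
  moreover have "?Q b a = ?Q a b"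
    by (auto simp: add_ac)
  ultimately show "(?Q a b \<longlongrightarrow> frechet_derivative (\<lambda>y. frechet_derivative f (at y) b) (at z) a) (at_right 0)"
    by simp
qed

section \<open>Calculus of the space-time derivatives\<close>

text \<open>Chain rule along the coordinate line through \<open>z\<close>. This, with its analogue
  for time, transfers the rules for Frechet derivatives to the coordinate derivatives.\<close>

lemma partial_x_eq_frechet:
  assumes "f differentiable (at z)"
  shows "partial_x i f z = frechet_derivative f (at z) (axis i 1, 0)"
proof -
  let ?\<gamma> = "\<lambda>h::real. (fst z + h *\<^sub>R axis i 1, snd z)"
  have \<gamma>: "(?\<gamma> has_derivative (\<lambda>h. h *\<^sub>R (axis i 1, 0))) (at 0)"
    by (auto intro!: derivative_eq_intros)
  have f: "(f has_derivative frechet_derivative f (at z)) (at (?\<gamma> 0))"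
    using assms by (simp flip: frechet_derivative_works)
  have "((\<lambda>h. f (?\<gamma> h)) has_vector_derivative frechet_derivative f (at z) (axis i 1, 0)) (at 0)"
    using diff_chain_at[OF \<gamma> f] linear_cmul[OF has_derivative_linear[OF f]]
    by (simp add: o_def has_vector_derivative_def del: scaleR_Pair)
  then show ?thesis
    unfolding partial_x_def by (rule vector_derivative_at)
qed

lemma partial_t_eq_frechet:
  assumes "f differentiable (at z)"
  shows "partial_t f z = frechet_derivative f (at z) (0, 1)"
proof -
  let ?\<gamma> = "\<lambda>s::real. (fst z, s)"
  have \<gamma>: "(?\<gamma> has_derivative (\<lambda>h. h *\<^sub>R (0, 1))) (at (snd z))"
    by (auto intro!: derivative_eq_intros)
  have f: "(f has_derivative frechet_derivative f (at z)) (at (?\<gamma> (snd z)))"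
    using assms by (simp flip: frechet_derivative_works)
  have "((\<lambda>s. f (?\<gamma> s)) has_vector_derivative frechet_derivative f (at z) (0, 1)) (at (snd z))"
    using diff_chain_at[OF \<gamma> f] linear_cmul[OF has_derivative_linear[OF f]]
    by (simp add: o_def has_vector_derivative_def del: scaleR_Pair)
  then show ?thesis
    unfolding partial_t_def by (rule vector_derivative_at)
qed

text \<open>Needed to differentiate identities that hold only on the domain: the preimage of the
  open set \<open>S\<close> under the coordinate line is a neighbourhood of 0, and the derivative
  sees nothing else.\<close>

lemma partial_x_cong_open:
  assumes "open S" "z \<in> S" "\<And>y. y \<in> S \<Longrightarrow> f y = g y"
  shows "partial_x i f z = partial_x i g z"
  unfolding partial_x_def
proof (rule vector_derivative_cong_eq)
  have "open ((\<lambda>h::real. (fst z + h *\<^sub>R axis i 1, snd z)) -` S)"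
    by (intro open_vimage assms continuous_intros)
  then have "\<forall>\<^sub>F h in nhds 0. h \<in> (\<lambda>h::real. (fst z + h *\<^sub>R axis i 1, snd z)) -` S"
    using assms by (intro eventually_nhds_in_open) auto
  then show "\<forall>\<^sub>F h in nhds 0. h \<in> UNIV \<longrightarrow>
      f (fst z + h *\<^sub>R axis i 1, snd z) = g (fst z + h *\<^sub>R axis i 1, snd z)"
    by eventually_elim (use assms in auto)
qed auto

lemma partial_t_cong_open:
  assumes "open S" "z \<in> S" "\<And>y. y \<in> S \<Longrightarrow> f y = g y"
  shows "partial_t f z = partial_t g z"
  unfolding partial_t_def
proof (rule vector_derivative_cong_eq)
  have "open ((\<lambda>s. (fst z, s)) -` S)"
    by (intro open_vimage assms continuous_intros)
  then have "\<forall>\<^sub>F s in nhds (snd z). s \<in> (\<lambda>s. (fst z, s)) -` S"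
    using assms by (intro eventually_nhds_in_open) auto
  then show "\<forall>\<^sub>F s in nhds (snd z). s \<in> UNIV \<longrightarrow> f (fst z, s) = g (fst z, s)"
    by eventually_elim (use assms in auto)
qed auto

lemma advect_cong_open:
  assumes "open S" "z \<in> S" "\<And>y. y \<in> S \<Longrightarrow> f y = g y"
  shows "advect v f z = advect v g z"
  unfolding advect_def using partial_x_cong_open[OF assms] by simp

text \<open>The advecting field enters by its value only and is not differentiated, so agreement at
  one point is enough.\<close>

lemma advect_cong_velocity: "v z = v' z \<Longrightarrow> advect v f z = advect v' f z"
  by (simp add: advect_def)

lemma material_deriv_cong_open:
  assumes "open S" "z \<in> S" "\<And>y. y \<in> S \<Longrightarrow> f y = g y"
  shows "material_deriv u f z = material_deriv u g z"
  unfolding material_deriv_def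
  using partial_t_cong_open[OF assms] advect_cong_open[OF assms] by simp

lemma grad_cong_open:
  assumes "open S" "z \<in> S" "\<And>y. y \<in> S \<Longrightarrow> f y = g y"
  shows "grad f z = grad g z"
  unfolding grad_def using partial_x_cong_open[OF assms] by simp

lemma differentiable_cong_open:
  assumes "open S" "z \<in> S" "\<And>y. y \<in> S \<Longrightarrow> f y = g y"
  shows "f differentiable (at z) \<longleftrightarrow> g differentiable (at z)"
  using has_derivative_transform_within_open[of f _ z UNIV S g]
    has_derivative_transform_within_open[of g _ z UNIV S f] assms
  unfolding differentiable_def by metis

section \<open>Components of vector fields\<close>

lemma differentiable_vec_nth:
  "f differentiable (at z) \<Longrightarrow> (\<lambda>y. f y $ i) differentiable (at z)"
  unfolding differentiable_def using bounded_linear.has_derivative[OF bounded_linear_vec_nth] by metis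

lemma frechet_derivative_vec_nth:
  assumes "f differentiable (at z)"
  shows "frechet_derivative (\<lambda>y. f y $ i) (at z) b = frechet_derivative f (at z) b $ i"
  using bounded_linear.has_derivative[OF bounded_linear_vec_nth assms[unfolded frechet_derivative_works], of i]
  by (metis frechet_derivative_at)

lemma partial_x_vec_nth:
  "f differentiable (at z) \<Longrightarrow> partial_x k (\<lambda>y. f y $ i) z = partial_x k f z $ i"
  by (simp add: partial_x_eq_frechet differentiable_vec_nth frechet_derivative_vec_nth)

lemma partial_t_vec_nth:
  "f differentiable (at z) \<Longrightarrow> partial_t (\<lambda>y. f y $ i) z = partial_t f z $ i"
  by (simp add: partial_t_eq_frechet differentiable_vec_nth frechet_derivative_vec_nth)

lemma advect_vec_nth:
  "f differentiable (at z) \<Longrightarrow> advect v (\<lambda>y. f y $ i) z = advect v f z $ i"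
  by (simp add: advect_def partial_x_vec_nth)

lemma material_deriv_vec_nth:
  "f differentiable (at z) \<Longrightarrow> material_deriv u (\<lambda>y. f y $ i) z = material_deriv u f z $ i"
  by (simp add: material_deriv_def partial_t_vec_nth advect_vec_nth)

section \<open>Product, sum and difference rules\<close>

lemma frechet_derivative_mult:
  fixes f g :: "'a::real_normed_vector \<Rightarrow> real"
  assumes "f differentiable (at z)" "g differentiable (at z)"
  shows "frechet_derivative (\<lambda>y. f y * g y) (at z) b
       = f z * frechet_derivative g (at z) b + frechet_derivative f (at z) b * g z"
  using has_derivative_mult[OF assms[unfolded frechet_derivative_works]]
  by (metis frechet_derivative_at)

lemma frechet_derivative_add:
  assumes "f differentiable (at z)" "g differentiable (at z)"
  shows "frechet_derivative (\<lambda>y. f y + g y) (at z) b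
       = frechet_derivative f (at z) b + frechet_derivative g (at z) b"
  using has_derivative_add[OF assms[unfolded frechet_derivative_works]]
  by (metis frechet_derivative_at)

lemma frechet_derivative_diff:
  assumes "f differentiable (at z)" "g differentiable (at z)"
  shows "frechet_derivative (\<lambda>y. f y - g y) (at z) b
       = frechet_derivative f (at z) b - frechet_derivative g (at z) b"
  using has_derivative_diff[OF assms[unfolded frechet_derivative_works]]
  by (metis frechet_derivative_at)

lemma frechet_derivative_sum:
  assumes "\<And>k. k \<in> A \<Longrightarrow> f k differentiable (at z)"
  shows "frechet_derivative (\<lambda>y. \<Sum>k\<in>A. f k y) (at z) b
       = (\<Sum>k\<in>A. frechet_derivative (f k) (at z) b)"
proof -
  have "((\<lambda>y. \<Sum>k\<in>A. f k y) has_derivative (\<lambda>b. \<Sum>k\<in>A. frechet_derivative (f k) (at z) b)) (at z)"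
    using assms frechet_derivative_works by (intro has_derivative_sum) blast
  then show ?thesis by (metis frechet_derivative_at)
qed

lemma partial_x_mult:
  fixes f g :: "'n::finite sfield"
  assumes "f differentiable (at z)" "g differentiable (at z)"
  shows "partial_x i (\<lambda>y. f y * g y) z = f z * partial_x i g z + partial_x i f z * g z"
  using assms by (simp add: partial_x_eq_frechet frechet_derivative_mult)

lemma partial_t_mult:
  fixes f g :: "'n::finite sfield"
  assumes "f differentiable (at z)" "g differentiable (at z)"
  shows "partial_t (\<lambda>y. f y * g y) z = f z * partial_t g z + partial_t f z * g z"
  using assms by (simp add: partial_t_eq_frechet frechet_derivative_mult)

lemma partial_x_add:
  assumes "f differentiable (at z)" "g differentiable (at z)"
  shows "partial_x i (\<lambda>y. f y + g y) z = partial_x i f z + partial_x i g z"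
  using assms by (simp add: partial_x_eq_frechet frechet_derivative_add)

lemma partial_t_add:
  assumes "f differentiable (at z)" "g differentiable (at z)"
  shows "partial_t (\<lambda>y. f y + g y) z = partial_t f z + partial_t g z"
  using assms by (simp add: partial_t_eq_frechet frechet_derivative_add)

lemma partial_x_diff:
  assumes "f differentiable (at z)" "g differentiable (at z)"
  shows "partial_x i (\<lambda>y. f y - g y) z = partial_x i f z - partial_x i g z"
  using assms by (simp add: partial_x_eq_frechet frechet_derivative_diff)

lemma partial_x_sum:
  assumes "finite A" "\<And>k. k \<in> A \<Longrightarrow> f k differentiable (at z)"
  shows "partial_x i (\<lambda>y. \<Sum>k\<in>A. f k y) z = (\<Sum>k\<in>A. partial_x i (f k) z)"
  using assms by (simp add: partial_x_eq_frechet frechet_derivative_sum)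

lemma partial_t_sum:
  assumes "finite A" "\<And>k. k \<in> A \<Longrightarrow> f k differentiable (at z)"
  shows "partial_t (\<lambda>y. \<Sum>k\<in>A. f k y) z = (\<Sum>k\<in>A. partial_t (f k) z)"
  using assms by (simp add: partial_t_eq_frechet frechet_derivative_sum)

lemma material_deriv_mult:
  fixes f g :: "'n::finite sfield"
  assumes "f differentiable (at z)" "g differentiable (at z)"
  shows "material_deriv u (\<lambda>y. f y * g y) z = f z * material_deriv u g z + material_deriv u f z * g z"
  using assms
  by (simp add: material_deriv_def advect_def partial_t_mult partial_x_mult algebra_simps
      sum.distrib sum_distrib_left)

lemma material_deriv_add:
  assumes "f differentiable (at z)" "g differentiable (at z)"
  shows "material_deriv u (\<lambda>y. f y + g y) z = material_deriv u f z + material_deriv u g z"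
  using assms
  by (simp add: material_deriv_def advect_def partial_t_add partial_x_add algebra_simps sum.distrib)

lemma material_deriv_sum:
  fixes f :: "'k \<Rightarrow> 'n::finite sfield"
  assumes "finite A" "\<And>k. k \<in> A \<Longrightarrow> f k differentiable (at z)"
  shows "material_deriv u (\<lambda>y. \<Sum>k\<in>A. f k y) z = (\<Sum>k\<in>A. material_deriv u (f k) z)"
  using assms
  by (simp add: material_deriv_def advect_def partial_t_sum partial_x_sum sum.distrib
      sum_distrib_left) (rule sum.swap)

lemma grad_minus:
  assumes "f differentiable (at z)"
  shows "grad (\<lambda>y. - f y) z = - grad f z"
  using assms partial_x_diff[OF differentiable_const assms, of _ 0]
  by (simp add: grad_def vec_eq_iff partial_x_eq_frechet)

section \<open>Twice differentiable fields\<close>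

text \<open>Differentiable first partials are what the symmetry of second derivatives consumes, and
  the property passes to products by the product rule.\<close>

definition twice_differentiable_field :: "'n::finite spacetime set \<Rightarrow> 'n sfield \<Rightarrow> bool" where
  "twice_differentiable_field S f \<longleftrightarrow>
     (\<forall>z\<in>S. f differentiable (at z) \<and> partial_t f differentiable (at z)
       \<and> (\<forall>i. partial_x i f differentiable (at z)))"

section \<open>From classes C^1 and C^2 to differentiability of fields and of their partials\<close>

lemma C_1_imp_differentiable:
  "C_k_on 1 S f \<Longrightarrow> z \<in> S \<Longrightarrow> f differentiable (at z)"
  by simp

text \<open>\<open>C_k_on\<close> speaks of derivatives along \<open>Basis\<close>; this and the
  next lemma place the space and time directions there.\<close>

lemma axis_in_Basis_spacetime: "(axis i 1, 0) \<in> (Basis :: 'n::finite spacetime set)"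
  by (auto simp: Basis_prod_def Basis_vec_def)

lemma time_in_Basis_spacetime: "(0, 1) \<in> (Basis :: 'n::finite spacetime set)"
  by (auto simp: Basis_prod_def)

lemma C_2_imp_differentiable:
  "C_k_on 2 S f \<Longrightarrow> z \<in> S \<Longrightarrow> f differentiable (at z)"
  by (simp add: numeral_2_eq_2)

lemma C_2_imp_partials_differentiable:
  assumes "C_k_on 2 S f" "open S" "z \<in> S"
  shows "partial_x i f differentiable (at z)" "partial_t f differentiable (at z)"
proof -
  have b: "(\<lambda>y. frechet_derivative f (at y) b) differentiable (at z)" if "b \<in> Basis" for b
    using assms that by (simp add: numeral_2_eq_2)
  have d: "f differentiable (at y)" if "y \<in> S" for y
    using assms(1) that by (rule C_2_imp_differentiable)
  have x: "partial_x i f y = frechet_derivative f (at y) (axis i 1, 0)"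
    and t: "partial_t f y = frechet_derivative f (at y) (0, 1)" if "y \<in> S" for y
    using d[OF that] by (simp_all add: partial_x_eq_frechet partial_t_eq_frechet)
  show "partial_x i f differentiable (at z)"
    using differentiable_cong_open[OF assms(2,3) x] b[OF axis_in_Basis_spacetime] by simp
  show "partial_t f differentiable (at z)"
    using differentiable_cong_open[OF assms(2,3) t] b[OF time_in_Basis_spacetime] by simp
qed

lemma C_2_imp_twice_differentiable_field:
  "C_k_on 2 S f \<Longrightarrow> open S \<Longrightarrow> twice_differentiable_field S f"
  unfolding twice_differentiable_field_def
  by (blast intro: C_2_imp_differentiable C_2_imp_partials_differentiable)

lemma C_2_imp_twice_differentiable_field_vec_nth:
  fixes f :: "'n::finite vfield"
  assumes "C_k_on 2 S f" "open S"
  shows "twice_differentiable_field S (\<lambda>y. f y $ k)"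
  unfolding twice_differentiable_field_def
proof (intro ballI conjI allI)
  fix z assume z: "z \<in> S"
  have d: "f differentiable (at y)" if "y \<in> S" for y
    using assms(1) that by (rule C_2_imp_differentiable)
  show "(\<lambda>y. f y $ k) differentiable (at z)"
    using d z differentiable_vec_nth by blast
  have x: "partial_x i (\<lambda>y. f y $ k) y = partial_x i f y $ k"
    and t: "partial_t (\<lambda>y. f y $ k) y = partial_t f y $ k" if "y \<in> S" for y i
    using d[OF that] by (simp_all add: partial_x_vec_nth partial_t_vec_nth)
  show "partial_t (\<lambda>y. f y $ k) differentiable (at z)"
    using differentiable_cong_open[OF assms(2) z t]
      differentiable_vec_nth[OF C_2_imp_partials_differentiable(2)[OF assms z]] by simp
  show "partial_x i (\<lambda>y. f y $ k) differentiable (at z)" for i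
    using differentiable_cong_open[OF assms(2) z x]
      differentiable_vec_nth[OF C_2_imp_partials_differentiable(1)[OF assms z]] by simp
qed

lemma twice_differentiable_field_mult:
  assumes f: "twice_differentiable_field S f" and g: "twice_differentiable_field S g" and "open S"
  shows "twice_differentiable_field S (\<lambda>y. f y * g y)"
  unfolding twice_differentiable_field_def
proof (intro ballI conjI allI)
  fix z assume z: "z \<in> S"
  note d = f[unfolded twice_differentiable_field_def, rule_format]
    g[unfolded twice_differentiable_field_def, rule_format]
  show "(\<lambda>y. f y * g y) differentiable (at z)"
    using d z by (intro differentiable_mult) auto
  have t: "partial_t (\<lambda>y. f y * g y) y = f y * partial_t g y + partial_t f y * g y"
    and x: "partial_x i (\<lambda>y. f y * g y) y = f y * partial_x i g y + partial_x i f y * g y"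
    if "y \<in> S" for y i
    using d that by (simp_all add: partial_t_mult partial_x_mult)
  have "(\<lambda>y. f y * partial_t g y + partial_t f y * g y) differentiable (at z)"
    using d z by (intro differentiable_add differentiable_mult) auto
  with differentiable_cong_open[OF \<open>open S\<close> z t]
  show "partial_t (\<lambda>y. f y * g y) differentiable (at z)" by simp
  have "(\<lambda>y. f y * partial_x i g y + partial_x i f y * g y) differentiable (at z)" for i
    using d z by (intro differentiable_add differentiable_mult) auto
  with differentiable_cong_open[OF \<open>open S\<close> z x]
  show "partial_x i (\<lambda>y. f y * g y) differentiable (at z)" for i by simp
qed

lemma twice_differentiable_field_imp_differentiable:
  assumes "twice_differentiable_field S f" "z \<in> S"
  shows "f differentiable (at z)" "partial_t f differentiable (at z)"
    "partial_x i f differentiable (at z)"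
  using assms by (auto simp: twice_differentiable_field_def)

text \<open>On \<open>S\<close> each partial is a Frechet derivative in a fixed direction, so
  iterated partials are iterated Frechet derivatives and symmetry applies.\<close>

lemma partial_x_commute:
  assumes f: "twice_differentiable_field S f" and S: "open S" "z \<in> S"
  shows "partial_x i (partial_x j f) z = partial_x j (partial_x i f) z"
    and "partial_x i (partial_t f) z = partial_t (partial_x i f) z"
proof -
  note d = twice_differentiable_field_imp_differentiable[OF f]
  let ?X = "\<lambda>i y. frechet_derivative f (at y) (axis i 1, 0)"
  let ?T = "\<lambda>y. frechet_derivative f (at y) (0, 1)"
  have eqx: "partial_x i f y = ?X i y" if "y \<in> S" for i y
    using d(1)[OF that] by (rule partial_x_eq_frechet)
  have eqt: "partial_t f y = ?T y" if "y \<in> S" for y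
    using d(1)[OF that] by (rule partial_t_eq_frechet)
  have x: "?X i differentiable (at z)" for i
    using differentiable_cong_open[OF S, of "partial_x i f" "?X i"] eqx d(3)[OF S(2)] by blast
  have t: "?T differentiable (at z)"
    using differentiable_cong_open[OF S, of "partial_t f" ?T] eqt d(2)[OF S(2)] by blast
  have xx: "partial_x i (partial_x j f) z = frechet_derivative (?X j) (at z) (axis i 1, 0)" for i j
    unfolding partial_x_eq_frechet[OF x, symmetric] using S eqx by (rule partial_x_cong_open)
  have xt: "partial_x i (partial_t f) z = frechet_derivative ?T (at z) (axis i 1, 0)"
    unfolding partial_x_eq_frechet[OF t, symmetric] using S eqt by (rule partial_x_cong_open)
  have tx: "partial_t (partial_x i f) z = frechet_derivative (?X i) (at z) (0, 1)"
    unfolding partial_t_eq_frechet[OF x, symmetric] using S eqx by (rule partial_t_cong_open)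
  show "partial_x i (partial_x j f) z = partial_x j (partial_x i f) z"
    unfolding xx using S d(1) x x by (rule frechet_derivative_symmetric)
  show "partial_x i (partial_t f) z = partial_t (partial_x i f) z"
    unfolding xt tx using S d(1) t x by (rule frechet_derivative_symmetric)
qed

text \<open>Second partials commute, so the commutator of a space derivative with the material
  derivative comes only from differentiating the coefficients \<open>u y $ j\<close>.\<close>

lemma partial_x_material_deriv:
  assumes f: "twice_differentiable_field S f" and S: "open S" "z \<in> S"
    and u: "\<And>j. (\<lambda>y. u y $ j) differentiable (at z)"
  shows "partial_x i (material_deriv u f) z = material_deriv u (partial_x i f) z
     + (\<Sum>j\<in>UNIV. partial_x i (\<lambda>y. u y $ j) z * partial_x j f z)"
proof -
  note d = twice_differentiable_field_imp_differentiable[OF f S(2)]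
  have "partial_x i (material_deriv u f) z
      = partial_x i (\<lambda>y. partial_t f y + (\<Sum>j\<in>UNIV. u y $ j * partial_x j f y)) z"
    by (simp add: material_deriv_def[abs_def] advect_def)
  also have "\<dots> = partial_x i (partial_t f) z
      + (\<Sum>j\<in>UNIV. u z $ j * partial_x i (partial_x j f) z
          + partial_x i (\<lambda>y. u y $ j) z * partial_x j f z)"
    using d u by (simp add: partial_x_add partial_x_sum partial_x_mult differentiable_mult)
  also have "\<dots> = material_deriv u (partial_x i f) z
     + (\<Sum>j\<in>UNIV. partial_x i (\<lambda>y. u y $ j) z * partial_x j f z)"
    using partial_x_commute(1)[OF f S, of i] partial_x_commute(2)[OF f S]
    by (simp add: material_deriv_def advect_def sum.distrib)
  finally show ?thesis .
qed

section \<open>Conservation of the perturbed mass and Galbrun's equation\<close>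

text \<open>The right-hand side is the divergence of \<open>\<rho>\<close> times
  \<open>\<delta>u\<close>, expanded to match the linearized continuity equation.\<close>

lemma material_deriv_divergence_density_displacement:
  fixes u w \<delta>u :: "'n::finite vfield" and \<rho> :: "'n sfield"
  assumes S: "open S" "z \<in> S"
    and u: "C_k_on 2 S u" and \<rho>: "C_k_on 2 S \<rho>" and w: "C_k_on 2 S w"
    and \<delta>u: "\<delta>u differentiable (at z)"
    and mass: "\<And>y. y \<in> S \<Longrightarrow> material_deriv u \<rho> y + \<rho> y * divergence u y = 0"
    and disp: "\<And>y. y \<in> S \<Longrightarrow> material_deriv u w y - advect w u y = \<delta>u y"
  shows "material_deriv u (divergence (\<lambda>y. \<rho> y *\<^sub>R w y)) z
       + divergence u z * divergence (\<lambda>y. \<rho> y *\<^sub>R w y) z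
       = \<rho> z * divergence \<delta>u z + advect \<delta>u \<rho> z"
proof -
  let ?v = "\<lambda>i y. \<rho> y * w y $ i"
  let ?u = "\<lambda>i y. u y $ i"
  let ?q = "divergence (\<lambda>y. \<rho> y *\<^sub>R w y)"
  have tu: "twice_differentiable_field S (?u i)" for i
    using u S(1) by (rule C_2_imp_twice_differentiable_field_vec_nth)
  have t\<rho>: "twice_differentiable_field S \<rho>"
    using \<rho> S(1) by (rule C_2_imp_twice_differentiable_field)
  have tw: "twice_differentiable_field S (\<lambda>y. w y $ i)" for i
    using w S(1) by (rule C_2_imp_twice_differentiable_field_vec_nth)
  have tv: "twice_differentiable_field S (?v i)" for i
    using t\<rho> tw S(1) by (rule twice_differentiable_field_mult)
  note du = twice_differentiable_field_imp_differentiable[OF tu]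
  note d\<rho> = twice_differentiable_field_imp_differentiable[OF t\<rho>]
  note dw = twice_differentiable_field_imp_differentiable[OF tw]
  note dv = twice_differentiable_field_imp_differentiable[OF tv]
  note d\<delta>u = differentiable_vec_nth[OF \<delta>u]
  \<comment> \<open>Product rule with both evolution equations inserted. It is proved on all of
    \<open>S\<close> because it is differentiated next.\<close>
  have transport: "material_deriv u (?v i) y = \<rho> y * \<delta>u y $ i
      + (\<Sum>j\<in>UNIV. ?v j y * partial_x j (?u i) y) - ?v i y * divergence u y"
    if y: "y \<in> S" for i y
  proof -
    have "material_deriv u (\<lambda>y. w y $ i) y = \<delta>u y $ i + advect w (?u i) y"
      using C_2_imp_differentiable[OF w y] C_2_imp_differentiable[OF u y]
      by (simp add: material_deriv_vec_nth advect_vec_nth flip: disp[OF y])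
    moreover have "material_deriv u \<rho> y = - (\<rho> y * divergence u y)"
      using mass[OF y] by simp
    ultimately show ?thesis
      using d\<rho>(1)[OF y] dw(1)[OF y]
      by (simp add: material_deriv_mult advect_def algebra_simps sum_distrib_left)
  qed
  \<comment> \<open>\<open>?A\<close> collects the second derivatives of the velocity,
    \<open>?B\<close> the products of first derivatives. In \<open>term_i\<close> both occur as a
    row sum minus the corresponding column sum, so they cancel on summation over
    \<open>i\<close>.\<close>
  let ?A = "\<lambda>i j. ?v j z * partial_x i (partial_x j (?u i)) z"
  let ?B = "\<lambda>i j. partial_x i (?v j) z * partial_x j (?u i) z"
  have term_i: "material_deriv u (partial_x i (?v i)) z
      = \<rho> z * partial_x i (\<lambda>y. \<delta>u y $ i) z + \<delta>u z $ i * partial_x i \<rho> z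
        - partial_x i (?v i) z * divergence u z
        + (\<Sum>j\<in>UNIV. ?A i j) - (\<Sum>j\<in>UNIV. ?A j i) + (\<Sum>j\<in>UNIV. ?B i j) - (\<Sum>j\<in>UNIV. ?B j i)"
    for i
  proof -
    \<comment> \<open>The column sum of \<open>?B\<close> is the commutator term of
      \<open>partial_x_material_deriv\<close>.\<close>
    have "material_deriv u (partial_x i (?v i)) z + (\<Sum>j\<in>UNIV. ?B j i)
        = partial_x i (material_deriv u (?v i)) z"
      using partial_x_material_deriv[OF tv S, of u i i] du(1)[OF S(2)] by (simp add: mult.commute)
    also have "\<dots> = partial_x i (\<lambda>y. \<rho> y * \<delta>u y $ i + (\<Sum>j\<in>UNIV. ?v j y * partial_x j (?u i) y)
        - ?v i y * (\<Sum>j\<in>UNIV. partial_x j (?u j) y)) z"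
      using S transport unfolding divergence_def by (rule partial_x_cong_open)
    also have "\<dots> = \<rho> z * partial_x i (\<lambda>y. \<delta>u y $ i) z + \<delta>u z $ i * partial_x i \<rho> z
        + ((\<Sum>j\<in>UNIV. ?A i j) + (\<Sum>j\<in>UNIV. ?B i j))
        - (?v i z * (\<Sum>j\<in>UNIV. partial_x i (partial_x j (?u j)) z)
            + partial_x i (?v i) z * divergence u z)"
    proof -
      have div_u: "(\<lambda>y. \<Sum>j\<in>UNIV. partial_x j (?u j) y) differentiable (at z)"
        using du(3)[OF S(2)] by (intro differentiable_sum) auto
      have 1: "partial_x i (\<lambda>y. \<rho> y * \<delta>u y $ i) z
          = \<rho> z * partial_x i (\<lambda>y. \<delta>u y $ i) z + \<delta>u z $ i * partial_x i \<rho> z"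
        using d\<rho>(1)[OF S(2)] d\<delta>u by (simp add: partial_x_mult)
      have 2: "partial_x i (\<lambda>y. \<Sum>j\<in>UNIV. ?v j y * partial_x j (?u i) y) z
          = (\<Sum>j\<in>UNIV. ?A i j) + (\<Sum>j\<in>UNIV. ?B i j)"
        using partial_x_mult[OF dv(1)[OF S(2)] du(3)[OF S(2)]]
          differentiable_mult[OF dv(1)[OF S(2)] du(3)[OF S(2)]]
        by (simp add: partial_x_sum sum.distrib)
      have 3: "partial_x i (\<lambda>y. ?v i y * (\<Sum>j\<in>UNIV. partial_x j (?u j) y)) z
          = ?v i z * (\<Sum>j\<in>UNIV. partial_x i (partial_x j (?u j)) z)
            + partial_x i (?v i) z * divergence u z"
        using partial_x_mult[OF dv(1)[OF S(2)] div_u, of i i] du(3)[OF S(2)]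
        by (simp add: partial_x_sum divergence_def)
      have s: "(\<lambda>y. \<rho> y * \<delta>u y $ i) differentiable (at z)"
        "(\<lambda>y. \<Sum>j\<in>UNIV. ?v j y * partial_x j (?u i) y) differentiable (at z)"
        "(\<lambda>y. ?v i y * (\<Sum>j\<in>UNIV. partial_x j (?u j) y)) differentiable (at z)"
        using d\<rho>(1)[OF S(2)] d\<delta>u dv(1)[OF S(2)] du(3)[OF S(2)]
          differentiable_mult[OF dv(1)[OF S(2)] du(3)[OF S(2)]] div_u
        by (auto intro!: differentiable_mult differentiable_sum)
      show ?thesis
        unfolding partial_x_diff[OF differentiable_add[OF s(1,2)] s(3)] partial_x_add[OF s(1,2)] 1 2 3 ..
    qed
    \<comment> \<open>Exchanging the two derivatives turns the gradient of the divergence of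
      \<open>u\<close> into a column sum of \<open>?A\<close>.\<close>
    also have "?v i z * (\<Sum>j\<in>UNIV. partial_x i (partial_x j (?u j)) z) = (\<Sum>j\<in>UNIV. ?A j i)"
      using partial_x_commute(1)[OF tu S] by (simp add: sum_distrib_left)
    finally show ?thesis by simp
  qed
  have swap: "(\<Sum>i\<in>UNIV. \<Sum>j\<in>UNIV. F i j) = (\<Sum>i\<in>UNIV. \<Sum>j\<in>UNIV. F j i)"
    for F :: "'n \<Rightarrow> 'n \<Rightarrow> real"
    by (rule sum.swap)
  have q: "?q = (\<lambda>y. \<Sum>i\<in>UNIV. partial_x i (?v i) y)"
    by (simp add: divergence_def fun_eq_iff)
  have "material_deriv u ?q z = (\<Sum>i\<in>UNIV. material_deriv u (partial_x i (?v i)) z)"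
    unfolding q using dv(3)[OF S(2)] by (intro material_deriv_sum) auto
  also have "\<dots> = (\<Sum>i\<in>UNIV. \<rho> z * partial_x i (\<lambda>y. \<delta>u y $ i) z) + (\<Sum>i\<in>UNIV. \<delta>u z $ i * partial_x i \<rho> z)
        - (\<Sum>i\<in>UNIV. partial_x i (?v i) z * divergence u z)"
    unfolding term_i sum.distrib sum_subtractf
    using swap[of ?A] swap[of ?B] by linarith
  also have "\<dots> = \<rho> z * divergence \<delta>u z + advect \<delta>u \<rho> z - ?q z * divergence u z"
    by (simp add: q divergence_def[of \<delta>u] advect_def sum_distrib_left sum_distrib_right)
  finally show ?thesis by (simp add: mult.commute)
qed

lemma divergence_density_displacement_differentiable:
  fixes w :: "'n::finite vfield"
  assumes "C_k_on 2 S \<rho>" "C_k_on 2 S w" "open S" "z \<in> S"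
  shows "divergence (\<lambda>y. \<rho> y *\<^sub>R w y) differentiable (at z)"
proof -
  have "twice_differentiable_field S (\<lambda>y. \<rho> y * w y $ i)" for i
    using assms by (intro twice_differentiable_field_mult C_2_imp_twice_differentiable_field
        C_2_imp_twice_differentiable_field_vec_nth)
  then have "(\<lambda>y. \<Sum>i\<in>UNIV. partial_x i (\<lambda>y. \<rho> y * w y $ i) y) differentiable (at z)"
    using twice_differentiable_field_imp_differentiable(3)[OF _ \<open>z \<in> S\<close>]
    by (intro differentiable_sum) auto
  then show ?thesis
    by (simp add: divergence_def[abs_def])
qed

text \<open>\<open>m\<close> and \<open>\<rho>\<close> solve the same linear equation. Applying the
  product rule to \<open>m\<close> as \<open>\<rho>\<close> times \<open>m / \<rho>\<close> makes
  the divergence terms cancel; this factorization holds on \<open>S\<close>, where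
  \<open>\<rho>\<close> is positive.\<close>

lemma material_deriv_divide_conserved:
  fixes m \<rho> :: "'n::finite sfield"
  assumes S: "open S" "z \<in> S" and pos: "\<And>y. y \<in> S \<Longrightarrow> 0 < \<rho> y"
    and d: "\<rho> differentiable (at z)" "m differentiable (at z)"
    and \<rho>: "material_deriv u \<rho> z + \<rho> z * divergence u z = 0"
    and m: "material_deriv u m z + m z * divergence u z = 0"
  shows "\<rho> z * material_deriv u (\<lambda>y. m y / \<rho> y) z = 0"
proof -
  have \<rho>z: "0 < \<rho> z" using pos S by blast
  have "material_deriv u m z = material_deriv u (\<lambda>y. \<rho> y * (m y / \<rho> y)) z"
    using S by (rule material_deriv_cong_open) (use pos in force)
  also have "\<dots> = \<rho> z * material_deriv u (\<lambda>y. m y / \<rho> y) z + material_deriv u \<rho> z * (m z / \<rho> z)"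
    using d \<rho>z by (intro material_deriv_mult differentiable_divide) auto
  also have "material_deriv u \<rho> z = - \<rho> z * divergence u z"
    using \<rho> by simp
  finally show ?thesis
    using m \<rho>z by (simp add: field_simps)
qed

text \<open>Regular enough is read as C^2 for \<open>u0\<close>, \<open>\<rho>0\<close> and
  \<open>w\<close>, which are differentiated twice, and C^1 for \<open>p0\<close>,
  \<open>\<delta>u\<close>, \<open>\<delta>\<rho>\<close> and \<open>\<delta>p\<close>. The no
  resonance assumption is the inner implication; its premise is the first conjunct.\<close>

theorem mainTheorem4:
  fixes \<Omega> :: "(real ^ 'n::finite) set" and T :: "real set"
    and \<Sigma> :: "real \<Rightarrow> real"
    and u0 \<phi>0 \<delta>u \<delta>\<phi> w :: "'n vfield"
    and p0 \<rho>0 c0 \<delta>p \<delta>\<rho> :: "'n sfield"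
  assumes "open \<Omega>" and "open T"
    and "\<forall>z\<in>\<Omega> \<times> T. 0 < \<rho>0 z"
    and "\<forall>z\<in>\<Omega> \<times> T. \<Sigma> differentiable (at (\<rho>0 z)) \<and> 0 \<le> deriv \<Sigma> (\<rho>0 z)
           \<and> c0 z = sqrt (deriv \<Sigma> (\<rho>0 z))"
    and "C_k_on 2 (\<Omega> \<times> T) u0" and "C_k_on 2 (\<Omega> \<times> T) \<rho>0" and "C_k_on 2 (\<Omega> \<times> T) w"
    and "C_k_on 1 (\<Omega> \<times> T) p0" and "C_k_on 1 (\<Omega> \<times> T) \<delta>u"
    and "C_k_on 1 (\<Omega> \<times> T) \<delta>\<rho>" and "C_k_on 1 (\<Omega> \<times> T) \<delta>p"
    and "euler_flow (\<Omega> \<times> T) \<Sigma> u0 p0 \<rho>0 \<phi>0"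
    and "linearized_euler (\<Omega> \<times> T) u0 p0 \<rho>0 c0 \<delta>u \<delta>p \<delta>\<rho> \<delta>\<phi>"
    and "\<forall>z\<in>\<Omega> \<times> T. partial_t w z + lie_deriv u0 w z = \<delta>u z"
  shows "(\<forall>z\<in>\<Omega> \<times> T. \<rho>0 z * material_deriv u0
            (\<lambda>y. (\<delta>\<rho> y + divergence (\<lambda>y'. \<rho>0 y' *\<^sub>R w y') y) / \<rho>0 y) z = 0)
    \<and> (((\<forall>z\<in>\<Omega> \<times> T. \<rho>0 z * material_deriv u0
            (\<lambda>y. (\<delta>\<rho> y + divergence (\<lambda>y'. \<rho>0 y' *\<^sub>R w y') y) / \<rho>0 y) z = 0)
          \<longrightarrow> (\<forall>z\<in>\<Omega> \<times> T. \<delta>\<rho> z + divergence (\<lambda>y. \<rho>0 y *\<^sub>R w y) z = 0))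
        \<longrightarrow> galbrun (\<Omega> \<times> T) u0 p0 \<rho>0 c0 w \<delta>\<phi>)"
proof -
  let ?Q = "\<Omega> \<times> T"
  let ?q = "divergence (\<lambda>y. \<rho>0 y *\<^sub>R w y)"
  have Q: "open ?Q" using assms(1,2) by (rule open_Times)
  have euler: "material_deriv u0 \<rho>0 z + \<rho>0 z * divergence u0 z = 0" if "z \<in> ?Q" for z
    using assms(12) that unfolding euler_flow_def by blast
  have lin_momentum: "\<rho>0 z *\<^sub>R material_deriv u0 \<delta>u z + grad \<delta>p z + \<rho>0 z *\<^sub>R advect \<delta>u u0 z
          - \<delta>\<rho> z *\<^sub>R ((1 / \<rho>0 z) *\<^sub>R grad p0 z) = \<rho>0 z *\<^sub>R \<delta>\<phi> z"
    and lin_mass: "material_deriv u0 \<delta>\<rho> z + \<rho>0 z * divergence \<delta>u z + advect \<delta>u \<rho>0 z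
          + divergence u0 z * \<delta>\<rho> z = 0"
    and lin_state: "\<delta>p z = (c0 z)\<^sup>2 * \<delta>\<rho> z" if "z \<in> ?Q" for z
    using assms(13) that unfolding linearized_euler_def by blast+
  have disp: "material_deriv u0 w z - advect w u0 z = \<delta>u z" if "z \<in> ?Q" for z
    using assms(14) that unfolding partial_t_plus_lie_deriv by blast
  have conserved: "\<rho>0 z * material_deriv u0 (\<lambda>y. (\<delta>\<rho> y + ?q y) / \<rho>0 y) z = 0" if z: "z \<in> ?Q" for z
  proof (rule material_deriv_divide_conserved[OF Q z _ _ _ euler[OF z]])
    have d: "?q differentiable (at z)" "\<delta>\<rho> differentiable (at z)" "\<delta>u differentiable (at z)"
      using divergence_density_displacement_differentiable[OF assms(6,7) Q z]
        C_1_imp_differentiable[OF assms(10) z] C_1_imp_differentiable[OF assms(9) z] by auto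
    then show "(\<lambda>y. \<delta>\<rho> y + ?q y) differentiable (at z)"
      by (intro differentiable_add)
    have "material_deriv u0 (\<lambda>y. \<delta>\<rho> y + ?q y) z = material_deriv u0 \<delta>\<rho> z + material_deriv u0 ?q z"
      using d(2,1) by (rule material_deriv_add)
    \<comment> \<open>The expanded divergence of \<open>\<rho>0\<close> times
      \<open>\<delta>u\<close> occurs with opposite signs in the two evolution equations for
      \<open>\<delta>\<rho>\<close> and \<open>?q\<close>.\<close>
    then show "material_deriv u0 (\<lambda>y. \<delta>\<rho> y + ?q y) z + (\<delta>\<rho> z + ?q z) * divergence u0 z = 0"
      using lin_mass[OF z]
        material_deriv_divergence_density_displacement[OF Q z assms(5-7) d(3) euler disp]
      by (simp add: algebra_simps)
    show "\<rho>0 differentiable (at z)"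
      using assms(6) z by (rule C_2_imp_differentiable)
    show "0 < \<rho>0 y" if "y \<in> ?Q" for y
      using assms(3) that by blast
  qed
  moreover have "galbrun ?Q u0 p0 \<rho>0 c0 w \<delta>\<phi>" if res: "\<And>z. z \<in> ?Q \<Longrightarrow> \<delta>\<rho> z + ?q z = 0"
    unfolding galbrun_def
  proof
    fix z assume z: "z \<in> ?Q"
    have \<delta>\<rho>: "\<delta>\<rho> y = - ?q y" if "y \<in> ?Q" for y
      using res[OF that] by simp
    \<comment> \<open>The product with \<open>c0\<close> squared equals \<open>- \<delta>p\<close>
      on the domain, so its gradient is obtained from the C^1 field \<open>\<delta>p\<close> and
      \<open>c0\<close> itself is never differentiated.\<close>
    have "grad (\<lambda>y. (c0 y)\<^sup>2 * ?q y) z = grad (\<lambda>y. - \<delta>p y) z"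
      using Q z by (rule grad_cong_open) (simp add: lin_state \<delta>\<rho>)
    also have "\<dots> = - grad \<delta>p z"
      using C_1_imp_differentiable[OF assms(11) z] by (rule grad_minus)
    finally have "grad \<delta>p z = - grad (\<lambda>y. (c0 y)\<^sup>2 * ?q y) z" by simp
    moreover have "material_deriv u0 (\<lambda>y. material_deriv u0 w y - advect w u0 y) z = material_deriv u0 \<delta>u z"
      using Q z disp by (rule material_deriv_cong_open)
    moreover have "advect (\<lambda>y. material_deriv u0 w y - advect w u0 y) u0 z = advect \<delta>u u0 z"
      by (rule advect_cong_velocity) (rule disp[OF z])
    ultimately show "\<rho>0 z *\<^sub>R material_deriv u0 (\<lambda>y. material_deriv u0 w y - advect w u0 y) z
        - grad (\<lambda>y. (c0 y)\<^sup>2 * ?q y) z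
        + \<rho>0 z *\<^sub>R advect (\<lambda>y. material_deriv u0 w y - advect w u0 y) u0 z
        + ?q z *\<^sub>R ((1 / \<rho>0 z) *\<^sub>R grad p0 z) = \<rho>0 z *\<^sub>R \<delta>\<phi> z"
      using lin_momentum[OF z] \<delta>\<rho>[OF z] by simp
  qed
  ultimately show ?thesis by blast
qed

end
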